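(* If a commutative formal field theory $\mathcal D\subset\mathcal K$ is invariant under $\sigma(L_+^\uparrow)$, then it is invariant under $S\circ\sigma'(g)$ for every $g\in L_+^\downarrow$.
   Context: Setting: $M$ real of dimension $d\ge3$ with Lorentzian $\eta$; $L_+^\uparrow$, $L_+^\downarrow$, $L_+=L_+^\uparrow\cup L_+^\downarrow$ the identity component, the time-reversing determinant-one component, and the determinant-one Lorentz group. $L_+(\mathbb C)$ (complex determinant-one isometries of $M^{\mathbb C}$) is identified with the complexification of $L_+^\uparrow$ and contains $L_+$. $\rho$ is a finite-dimensional real representation of $L_+^\uparrow$ on $V$, $\rho^{\mathbb C}$ its holomorphic extension to $L_+(\mathbb C)$ on $V^{\mathbb C}$, and $\rho'$ the representation of $L_+$ on $V$ obtained by restricting $\rho^{\mathbb C}$ (which preserves $V$ on $L_+$); $\omega,\omega'$ likewise for a representation $\omega$ of $L_+^\uparrow$ on $M$. $W=\mathrm{Hom}_{\mathbb R}(V,\mathbb C)$, $\mathcal K=\mathcal F(W\otimes_{\mathbb R}TM)$ the free non-commutative complex algebra on field symbols $\underline\Phi^\lambda_{\xi_1\cdots\xi_n}=\lambda\otimes(\xi_1\otimes\cdots\otimes\xi_n)$ ($TM$ the real tensor algebra). The classical action induced by $\rho,\omega$ is the representation by complex-linear algebra automorphisms with $\sigma(g)\underline\Phi^\lambda_{\xi_1\cdots\xi_n}=\underline\Phi^{\lambda\circ\rho(g^{-1})}_{\omega(g)\xi_1\cdots\omega(g)\xi_n}$; $\sigma$ is that of $L_+^\uparrow$ (from $\rho,\omega$)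 and $\sigma'$ that of $L_+$ (from $\rho',\omega'$). Let $c\colon\mathcal K\to\mathcal K_c=\mathcal F_c(W\otimes_{\mathbb R}TM)$ be the quotient onto the free commutative complex algebra. A commutative formal field theory is a subset $\mathcal D=c^{-1}(\mathcal D_c)\subset\mathcal K$ where $\mathcal D_c$ is a complex affine subspace of $\mathcal K_c$. $S\colon\mathcal K\to\mathcal K$ is the unique additive, complex-linear anti-automorphism ($S(XY)=S(Y)S(X)$) fixing every field symbol. Invariance means mapping $\mathcal D$ into $\mathcal D$. *)

theory Defs
  imports "HOL-Analysis.Analysis" "HOL-Library.Multiset"
begin

text \<open>M = R^'d, d = CARD('d), with Lorentzian metric eta = diag with +1 at the
time index t and -1 elsewhere. Group elements are represented as complex
d x d matrices (elements of M^C = C^'d).\<close>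

definition eta :: "'d::finite \<Rightarrow> complex^'d^'d" where
  "eta t = (\<chi> i j. if i = j then (if i = t then 1 else -1) else 0)"

definition Lc :: "'d::finite \<Rightarrow> (complex^'d^'d) set" where
  "Lc t = {g. transpose g ** eta t ** g = eta t \<and> det g = 1}"

definition Lplus :: "'d::finite \<Rightarrow> (complex^'d^'d) set" where
  "Lplus t = {g \<in> Lc t. \<forall>i j. Im (g$i$j) = 0}"

text \<open>L_+^up (identity component, time-orientation preserving) and
L_+^down (time-reversing component).\<close>
definition Lup :: "'d::finite \<Rightarrow> (complex^'d^'d) set" where
  "Lup t = {g \<in> Lplus t. Re (g$t$t) > 0}"

definition Ldown :: "'d::finite \<Rightarrow> (complex^'d^'d) set" where
  "Ldown t = {g \<in> Lplus t. Re (g$t$t) < 0}"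

definition cmat :: "real^'a^'b \<Rightarrow> complex^'a^'b" where
  "cmat A = (\<chi> i j. complex_of_real (A$i$j))"

definition cscale :: "complex \<Rightarrow> complex^'a^'b \<Rightarrow> complex^'a^'b" where
  "cscale c A = (\<chi> i j. c * A$i$j)"

definition real_rep :: "(complex^'d^'d) set \<Rightarrow> (complex^'d^'d \<Rightarrow> real^'m^'m) \<Rightarrow> bool" where
  "real_rep G r \<longleftrightarrow> r (mat 1) = mat 1 \<and> (\<forall>g\<in>G. \<forall>h\<in>G. r (g ** h) = r g ** r h)"

text \<open>Holomorphic maps on a subset S of C^(d x d) (used for the complex submanifold
L_+(C)): locally the restriction of a complex-differentiable map on an open set.\<close>
definition holo_on :: "(complex^'d^'d) set \<Rightarrow> (complex^'d^'d \<Rightarrow> complex^'m^'m) \<Rightarrow> bool" where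
  "holo_on S F \<longleftrightarrow> (\<forall>g\<in>S. \<exists>U G. open U \<and> g \<in> U \<and>
      (\<forall>h\<in>U. \<exists>G'. (G has_derivative G') (at h) \<and> (\<forall>A. G' (cscale \<i> A) = cscale \<i> (G' A))) \<and>
      (\<forall>h\<in>U \<inter> S. G h = F h))"

definition holo_rep :: "(complex^'d^'d) set \<Rightarrow> (complex^'d^'d \<Rightarrow> complex^'m^'m) \<Rightarrow> bool" where
  "holo_rep G R \<longleftrightarrow> R (mat 1) = mat 1 \<and> (\<forall>g\<in>G. \<forall>h\<in>G. R (g ** h) = R g ** R h) \<and> holo_on G R"

text \<open>W = Hom_R(V,C) = C^'m (lambda(v) = sum_i lambda_i v_i); W tensor_R TM has the complex
basis e_i^* (x) e_j1 (x) ... (x) e_jn, indexed by ('m \<times> 'd list). K = free (non-commutative)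
complex algebra on it = finitely supported functions on words in this basis.\<close>

type_synonym ('m,'d) gen = "'m \<times> 'd list"
type_synonym ('m,'d) K = "('m,'d) gen list \<Rightarrow> complex"
type_synonym ('m,'d) Kc = "('m,'d) gen multiset \<Rightarrow> complex"

definition Kset :: "('m,'d) K set" where
  "Kset = {p. finite {w. p w \<noteq> 0}}"

definition Kcset :: "('m,'d) Kc set" where
  "Kcset = {q. finite {M. q M \<noteq> 0}}"

definition kone :: "('m,'d) K" where
  "kone = (\<lambda>w. if w = [] then 1 else 0)"

definition kmul :: "('m,'d) K \<Rightarrow> ('m,'d) K \<Rightarrow> ('m,'d) K" where
  "kmul p q = (\<lambda>w. \<Sum>k\<in>{0..length w}. p (take k w) * q (drop k w))"

definition kprod :: "('m,'d) K list \<Rightarrow> ('m,'d) K" where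
  "kprod xs = foldr kmul xs kone"

definition kgen :: "('m,'d) gen \<Rightarrow> ('m,'d) K" where
  "kgen x = (\<lambda>w. if w = [x] then 1 else 0)"

definition kext :: "(('m,'d) gen \<Rightarrow> ('m,'d) K) \<Rightarrow> ('m,'d) K \<Rightarrow> ('m,'d) K" where
  "kext f p = (\<lambda>v. \<Sum>w\<in>{w. p w \<noteq> 0}. p w * kprod (map f w) v)"

definition kext_anti :: "(('m,'d) gen \<Rightarrow> ('m,'d) K) \<Rightarrow> ('m,'d) K \<Rightarrow> ('m,'d) K" where
  "kext_anti f p = (\<lambda>v. \<Sum>w\<in>{w. p w \<noteq> 0}. p w * kprod (rev (map f w)) v)"

text \<open>Field symbol Phi^lambda_{xi_1...xi_n} = lambda (x) xi_1 (x) ... (x) xi_n as an element of K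
(expanded in the basis; the xi's are taken in M^C, which for real xi is the literal one).\<close>
definition field_symbol :: "complex^'m \<Rightarrow> (complex^'d) list \<Rightarrow> ('m::finite,'d::finite) K" where
  "field_symbol lam xis = (\<lambda>w. case w of
      [(i, js)] \<Rightarrow> (if length js = length xis
                   then lam$i * (\<Prod>k<length js. (xis!k)$(js!k)) else 0)
    | _ \<Rightarrow> 0)"

definition S_anti :: "('m::finite,'d::finite) K \<Rightarrow> ('m,'d) K" where
  "S_anti = kext_anti kgen"

text \<open>Classical action induced by (matrix-valued) representations R on V (acting on W by
lambda \<mapsto> lambda o R(g^-1)) and Om on M:
sigma(g) Phi^lambda_{xi..} = Phi^{lambda o R(g^-1)}_{Om(g) xi ..}, extended to an algebra map.\<close>
definition classical_action ::
  "(complex^'d^'d \<Rightarrow> complex^'m^'m) \<Rightarrow> (complex^'d^'d \<Rightarrow> complex^'d^'d) \<Rightarrow> complex^'d^'d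
     \<Rightarrow> ('m::finite,'d::finite) K \<Rightarrow> ('m,'d) K" where
  "classical_action R Om g = kext (\<lambda>(i, js).
      field_symbol (axis i 1 v* R (matrix_inv g)) (map (\<lambda>j. Om g *v axis j 1) js))"

definition cquot :: "('m,'d) K \<Rightarrow> ('m,'d) Kc" where
  "cquot p = (\<lambda>M. \<Sum>w\<in>{w. mset w = M}. p w)"

definition complex_affine :: "('m,'d) Kc set \<Rightarrow> bool" where
  "complex_affine A \<longleftrightarrow> A \<noteq> {} \<and> A \<subseteq> Kcset \<and>
     (\<forall>x\<in>A. \<forall>y\<in>A. \<forall>u v::complex. u + v = 1 \<longrightarrow> (\<lambda>M. u * x M + v * y M) \<in> A)"

definition comm_ffth :: "('m,'d) K set \<Rightarrow> bool" where
  "comm_ffth D \<longleftrightarrow> (\<exists>Dc. complex_affine Dc \<and> D = {p \<in> Kset. cquot p \<in> Dc})"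

definition invariant_under :: "(('m,'d) K \<Rightarrow> ('m,'d) K) \<Rightarrow> ('m,'d) K set \<Rightarrow> bool" where
  "invariant_under F D \<longleftrightarrow> (\<forall>p\<in>D. F p \<in> D)"

end

theory Submission
  imports Defs "HOL-Complex_Analysis.Conformal_Mappings" "HOL-Library.Function_Algebras"
begin

text \<open>If \<open>B(z)\<close> denotes the complexified boost in a time-like plane, then \<open>B(\<i>\<pi>)\<close> reverses time, so
for \<open>g\<close> time-reversing the curve \<open>z \<mapsto> g B(z + \<i>\<pi>)\<close> in the complex Lorentz group takes values in the
orthochronous group for real \<open>z\<close> and reaches \<open>g\<close> at \<open>z = -\<i>\<pi>\<close>. The commutative image of a fixed
polynomial, transported along this curve, is an entire function with values in a finite-dimensional
space of polynomials, since the action preserves the tensor degrees of the field symbols. It lies in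
the affine subspace \<open>Dc\<close> for real \<open>z\<close>; a linear functional cutting out the direction space
of \<open>Dc\<close> therefore annihilates it along the whole curve. Finally \<open>S\<close> only reverses words, which is
invisible in the commutative quotient.\<close>

unbundle no fps_syntax

section \<open>Linear functionals and an identity theorem for affine subspaces\<close>

text \<open>A basis of \<open>S\<close> stays independent when \<open>d\<close> is adjoined, so the
  values 0 on that basis and 1 at \<open>d\<close> extend linearly. The argument is purely
  algebraic, so the ambient space may have infinite dimension.\<close>

lemma separating_functional:
  fixes S :: "('k \<Rightarrow> complex) set"
  assumes zero: "0 \<in> S"
    and add: "\<And>x y. x \<in> S \<Longrightarrow> y \<in> S \<Longrightarrow> x + y \<in> S"
    and scale: "\<And>c x. x \<in> S \<Longrightarrow> (\<lambda>k. c * x k) \<in> S"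
    and "d \<notin> S"
  obtains g :: "('k \<Rightarrow> complex) \<Rightarrow> complex"
  where "\<And>x y. g (x + y) = g x + g y" "\<And>c x. g (\<lambda>k. c * x k) = c * g x"
    "\<And>x. x \<in> S \<Longrightarrow> g x = 0" "g d = 1"
proof -
  define sc where "sc = (\<lambda>c (f :: 'k \<Rightarrow> complex) k. c * f k)"
  interpret P: vector_space_pair sc "(*) :: complex \<Rightarrow> complex \<Rightarrow> complex"
    by unfold_locales (auto simp: sc_def fun_eq_iff algebra_simps)
  have sub: "P.vs1.subspace S"
    unfolding P.vs1.subspace_def using zero add scale by (auto simp: sc_def)
  obtain B where B: "B \<subseteq> S" "P.vs1.independent B" "S \<subseteq> P.vs1.span B"
    using P.vs1.maximal_independent_subset by blast
  have span: "P.vs1.span B = S"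
    using B sub P.vs1.span_minimal by blast
  have "P.vs1.independent (insert d B)"
    using B span \<open>d \<notin> S\<close> by (simp add: P.vs1.independent_insert)
  then obtain g where g: "Vector_Spaces.linear sc (*) g" "\<forall>x\<in>insert d B. g x = (if x = d then 1 else 0)"
    using P.linear_independent_extend[of "insert d B" "\<lambda>x. if x = d then 1 else 0"] by blast
  interpret g: Vector_Spaces.linear sc "(*)" g by fact
  show ?thesis
  proof
    show "g (x + y) = g x + g y" for x y by (rule g.add)
    show "g (\<lambda>k. c * x k) = c * g x" for c x using g.scale[of c x] by (simp add: sc_def)
    show "g d = 1" using g by simp
    fix x assume "x \<in> S"
    moreover have "d \<notin> B" using B \<open>d \<notin> S\<close> by blast
    then have "g b = 0" if "b \<in> B" for b using g(2) that by auto
    ultimately show "g x = 0"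
      using g.eq_0_on_span[of B x] span by blast
  qed
qed

text \<open>The real points accumulate at 0, so analytic continuation applies.\<close>

lemma entire_zero_of_real_zero:
  assumes "f holomorphic_on UNIV" "\<And>x::real. f (of_real x) = 0"
  shows "f w = 0"
proof (rule analytic_continuation[of f UNIV \<real> 0])
  have "(0::complex) islimpt \<real>"
    unfolding islimpt_approachable
  proof (intro allI impI)
    fix e :: real assume "e > 0"
    then show "\<exists>x'\<in>\<real>. x' \<noteq> (0::complex) \<and> dist x' 0 < e"
      by (intro bexI[of _ "of_real (e/2)"]) (auto simp: norm_divide)
  qed
  then show "(0::complex) islimpt \<real>" .
qed (use assms in \<open>auto elim!: Reals_cases\<close>)

text \<open>If \<open>q w\<close> left \<open>A\<close>, a functional vanishing on the direction
  space of \<open>A\<close> would separate \<open>q w - q 0\<close> from it; along the curve that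
  functional is entire and vanishes at real points, hence everywhere.\<close>

lemma affine_identity:
  fixes q :: "complex \<Rightarrow> 'k \<Rightarrow> complex"
  assumes aff: "\<And>x y u v. x \<in> A \<Longrightarrow> y \<in> A \<Longrightarrow> u + v = 1 \<Longrightarrow> (\<lambda>k. u * x k + v * y k) \<in> A"
    and X: "finite X" "\<And>z k. k \<notin> X \<Longrightarrow> q z k = 0"
    and hol: "\<And>k. (\<lambda>z. q z k) holomorphic_on UNIV"
    and real: "\<And>x::real. q (of_real x) \<in> A"
  shows "q w \<in> A"
proof (rule ccontr)
  assume "q w \<notin> A"
  \<comment> \<open>The base point is taken on the curve: it lies in \<open>A\<close> because 0 is
    real, and \<open>q z - x0\<close> stays supported in \<open>X\<close>.\<close>
  define x0 where "x0 = q 0"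
  have x0: "x0 \<in> A" using real[of 0] by (simp add: x0_def)
  define S where "S = {d. x0 + d \<in> A}"
  have zero: "0 \<in> S" using x0 by (simp add: S_def)
  have scale: "(\<lambda>k. c * x k) \<in> S" if "x \<in> S" for c x
  proof -
    have "(\<lambda>k. (1 - c) * x0 k + c * (x0 + x) k) \<in> A"
      using that x0 by (intro aff) (auto simp: S_def plus_fun_def)
    also have "(\<lambda>k. (1 - c) * x0 k + c * (x0 + x) k) = x0 + (\<lambda>k. c * x k)"
      by (auto simp: fun_eq_iff algebra_simps)
    finally show ?thesis unfolding S_def by blast
  qed
  have add: "x + y \<in> S" if "x \<in> S" "y \<in> S" for x y
  proof -
    \<comment> \<open>Only combinations with weights summing to 1 stay in \<open>A\<close>, so the
      sum is obtained as twice a midpoint.\<close>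
    have "(\<lambda>k. 1/2 * (x0 + x) k + 1/2 * (x0 + y) k) \<in> A"
      using that by (intro aff) (auto simp: S_def plus_fun_def)
    also have "(\<lambda>k. 1/2 * (x0 + x) k + 1/2 * (x0 + y) k) = x0 + (\<lambda>k. 1/2 * (x + y) k)"
      by (auto simp: fun_eq_iff field_simps)
    finally have "(\<lambda>k. 1/2 * (x + y) k) \<in> S" unfolding S_def by blast
    from scale[OF this, of 2] have "(\<lambda>k. 2 * (1/2 * (x + y) k)) \<in> S" .
    also have "(\<lambda>k. 2 * (1/2 * (x + y) k)) = x + y" by (simp add: fun_eq_iff)
    finally show ?thesis .
  qed
  have "q w - x0 \<notin> S" using \<open>q w \<notin> A\<close> by (simp add: S_def)
  from separating_functional[OF zero add scale this]
  obtain g :: "('k \<Rightarrow> complex) \<Rightarrow> complex" where gadd: "\<And>x y. g (x + y) = g x + g y"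
    and gsc: "\<And>c x. g (\<lambda>k. c * x k) = c * g x"
    and g0: "\<And>x. x \<in> S \<Longrightarrow> g x = 0" and g1: "g (q w - x0) = 1" by blast
  have gz: "g (\<lambda>k. 0) = 0" using gsc[of 0] by simp
  have gsum: "g (\<lambda>k. \<Sum>m\<in>Y. f m k) = (\<Sum>m\<in>Y. g (f m))" if "finite Y" for Y :: "'k set" and f
    using that
  proof induction
    case (insert a F)
    have "g (\<lambda>k. \<Sum>m\<in>insert a F. f m k) = g (f a + (\<lambda>k. \<Sum>m\<in>F. f m k))"
      using insert.hyps by (intro arg_cong[of _ _ g]) (auto simp: fun_eq_iff)
    then show ?case using insert by (simp add: gadd)
  qed (simp add: gz)
  define e where "e m = (\<lambda>k. if k = m then 1 else 0 :: complex)" for m :: 'k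
  \<comment> \<open>No continuity of \<open>g\<close> is available; on functions supported in the
    finite set \<open>X\<close> it is a finite combination of coordinates, which makes it
    holomorphic along \<open>q\<close>.\<close>
  have "g (q z - x0) = (\<Sum>m\<in>X. (q z m - x0 m) * g (e m))" for z
  proof -
    have "q z - x0 = (\<lambda>k. \<Sum>m\<in>X. (q z m - x0 m) * e m k)"
    proof
      fix k
      show "(q z - x0) k = (\<Sum>m\<in>X. (q z m - x0 m) * e m k)"
        using X(1) X(2)[of k] by (cases "k \<in> X") (auto simp: e_def x0_def if_distrib cong: if_cong)
    qed
    then have "g (q z - x0) = g (\<lambda>k. \<Sum>m\<in>X. (q z m - x0 m) * e m k)" by simp
    also have "\<dots> = (\<Sum>m\<in>X. (q z m - x0 m) * g (e m))"
      by (simp add: gsum[OF X(1)] gsc)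
    finally show ?thesis .
  qed
  moreover have "(\<lambda>z. \<Sum>m\<in>X. (q z m - x0 m) * g (e m)) holomorphic_on UNIV"
    by (intro holomorphic_intros hol)
  ultimately have "(\<lambda>z. g (q z - x0)) holomorphic_on UNIV" by simp
  moreover have "g (q (of_real x) - x0) = 0" for x :: real
    using real[of x] by (intro g0) (simp add: S_def)
  ultimately have "g (q w - x0) = 0"
    by (rule entire_zero_of_real_zero)
  with g1 show False by simp
qed

section \<open>Holomorphic maps along holomorphic curves\<close>

text \<open>The chain rule applied to the local extension \<open>G\<close>, which agrees with
  \<open>F\<close> along the curve because the curve stays in \<open>S\<close>.\<close>

lemma holo_on_compose:
  fixes F :: "complex^'d^'d \<Rightarrow> complex^'m^'m"
  assumes F: "holo_on S F" and S: "\<And>z. \<gamma> z \<in> S"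
    and \<gamma>: "\<And>i j. (\<lambda>z. \<gamma> z $ i $ j) holomorphic_on UNIV"
  shows "(\<lambda>z. F (\<gamma> z) $ k $ l) holomorphic_on UNIV"
proof -
  have "(\<lambda>z. F (\<gamma> z) $ k $ l) field_differentiable at z" for z
  proof -
    obtain U G where UG: "open U \<and> \<gamma> z \<in> U \<and>
        (\<forall>h\<in>U. \<exists>G'. (G has_derivative G') (at h) \<and> (\<forall>A. G' (cscale \<i> A) = cscale \<i> (G' A))) \<and>
        (\<forall>h\<in>U \<inter> S. G h = F h)"
      using bspec[OF F[unfolded holo_on_def] S[of z]] by (elim exE) (rule that)
    note U = UG[THEN conjunct1] UG[THEN conjunct2, THEN conjunct1]
      and G = UG[THEN conjunct2, THEN conjunct2, THEN conjunct1]
      and GF = UG[THEN conjunct2, THEN conjunct2, THEN conjunct2]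
    obtain G' where G': "(G has_derivative G') (at (\<gamma> z))"
      and G'i: "\<And>A. G' (cscale \<i> A) = cscale \<i> (G' A)"
      using bspec[OF G U(2)] by blast
    define D where "D = (\<chi> i j. deriv (\<lambda>z. \<gamma> z $ i $ j) z)"
    have d\<gamma>: "((\<lambda>z. \<gamma> z $ i $ j) has_field_derivative D $ i $ j) (at z)" for i j
      using holomorphic_derivI[OF \<gamma>[of i j]] by (simp add: D_def)
    have "(\<gamma> has_derivative (\<lambda>h. cscale h D)) (at z)"
      unfolding has_derivative_componentwise_within[of \<gamma>]
    proof
      fix b :: "complex^'d^'d" assume "b \<in> Basis"
      then obtain i j u where b: "b = axis i (axis j u)" by (auto simp: Basis_vec_def)
      have "((\<lambda>z. \<gamma> z $ i $ j \<bullet> u) has_derivative (\<lambda>h. (D $ i $ j * h) \<bullet> u)) (at z)"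
        using d\<gamma>[of i j] unfolding has_field_derivative_def by (rule has_derivative_inner_left)
      then show "((\<lambda>z. \<gamma> z \<bullet> b) has_derivative (\<lambda>h. cscale h D \<bullet> b)) (at z)"
        by (simp add: b inner_axis cscale_def mult.commute)
    qed
    then have "((\<lambda>z. G (\<gamma> z)) has_derivative (\<lambda>h. G' (cscale h D))) (at z)"
      using G' has_derivative_compose by blast
    then have "((\<lambda>z. G (\<gamma> z) $ k $ l) has_derivative (\<lambda>h. G' (cscale h D) $ k $ l)) (at z)"
      by (intro bounded_linear.has_derivative[OF bounded_linear_vec_nth])
    moreover have "G' (cscale h D) = cscale h (G' D)" for h
    proof -
      interpret G': bounded_linear G' using G' by (rule has_derivative_bounded_linear)
      \<comment> \<open>A real-linear map commuting with multiplication by i commutes with every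
        complex scalar, by splitting it into real and imaginary parts.\<close>
      have cs: "cscale h A = Re h *\<^sub>R A + Im h *\<^sub>R cscale \<i> A" for A :: "complex^'a^'b"
        by (simp add: cscale_def vec_eq_iff complex_eq_iff)
      show ?thesis by (simp add: cs[of D] cs[of "G' D"] G'.add G'.scaleR G'i)
    qed
    ultimately have "((\<lambda>z. G (\<gamma> z) $ k $ l) has_derivative (\<lambda>h. cscale h (G' D) $ k $ l)) (at z)"
      by simp
    moreover have "(\<lambda>h. cscale h (G' D) $ k $ l) = (*) (G' D $ k $ l)"
      by (simp add: fun_eq_iff cscale_def)
    ultimately have "((\<lambda>z. G (\<gamma> z) $ k $ l) has_field_derivative (G' D $ k $ l)) (at z)"
      by (simp add: has_field_derivative_def)
    \<comment> \<open>Continuity makes the preimage of \<open>U\<close> an open neighbourhood of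
      \<open>z\<close>, on which \<open>F\<close> may replace \<open>G\<close>.\<close>
    moreover have "continuous_on UNIV (\<lambda>z. \<chi> i j. \<gamma> z $ i $ j)"
      by (intro continuous_on_vec_lambda holomorphic_on_imp_continuous_on \<gamma>)
    then have "open (\<gamma> -` U)" using U(1) by (simp add: open_vimage)
    ultimately have "((\<lambda>z. F (\<gamma> z) $ k $ l) has_field_derivative (G' D $ k $ l)) (at z)"
      using U(2) GF S by (elim has_field_derivative_transform_within_open[where S = "\<gamma> -` U"]) auto
    then show ?thesis by (auto simp: field_differentiable_def)
  qed
  then show ?thesis by (simp add: holomorphic_on_def field_differentiable_at_within)
qed

section \<open>Inverses and rows in the complex Lorentz group\<close>

lemma eta_mult: "(eta t ** A) $ i $ j = (if i = t then 1 else -1) * A $ i $ j"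
  by (simp add: matrix_matrix_mult_def eta_def if_distrib[of "\<lambda>c. c * _"] cong: if_cong)

lemma mult_eta: "(A ** eta t) $ i $ j = A $ i $ j * (if j = t then 1 else -1)"
  by (simp add: matrix_matrix_mult_def eta_def if_distrib[of "\<lambda>c. _ * c"] cong: if_cong)

lemma eta_eta: "eta t ** eta t = mat 1"
  by (simp add: vec_eq_iff eta_mult) (simp add: eta_def mat_def)

lemma transpose_eta: "transpose (eta t) = eta t"
  by (simp add: vec_eq_iff transpose_def eta_def)

lemma det_eta_squared: "det (eta t) * det (eta t) = 1"
  by (metis det_I det_mul eta_eta)

lemma Lc_inverse:
  assumes "g \<in> Lc t"
  shows "matrix_inv g = eta t ** transpose g ** eta t"
    and "g ** (eta t ** transpose g ** eta t) = mat 1"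
proof -
  have "(eta t ** transpose g ** eta t) ** g = eta t ** (transpose g ** eta t ** g)"
    by (simp add: matrix_mul_assoc)
  also have "\<dots> = mat 1" using assms by (simp add: Lc_def eta_eta)
  finally have l: "(eta t ** transpose g ** eta t) ** g = mat 1" .
  then show r: "g ** (eta t ** transpose g ** eta t) = mat 1"
    by (simp add: matrix_left_right_inverse)
  \<comment> \<open>\<open>matrix_inv\<close> is defined by choice, so its properties follow only
    once some two-sided inverse is exhibited.\<close>
  have "g ** matrix_inv g = mat 1 \<and> matrix_inv g ** g = mat 1"
    unfolding matrix_inv_def using l r by (intro someI) auto
  then have "matrix_inv g ** g = mat 1" by blast
  then have "matrix_inv g ** (g ** (eta t ** transpose g ** eta t)) = eta t ** transpose g ** eta t"
    by (simp add: matrix_mul_assoc)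
  then show "matrix_inv g = eta t ** transpose g ** eta t" by (simp add: r)
qed

text \<open>Turns the column relations defining \<open>Lc\<close> into row relations, through the
  right inverse of \<open>g\<close>.\<close>

lemma Lc_transpose:
  assumes "g \<in> Lc t"
  shows "g ** eta t ** transpose g = eta t"
proof -
  have "g ** eta t ** transpose g = (g ** (eta t ** transpose g ** eta t)) ** eta t"
    by (simp add: matrix_mul_assoc[symmetric] eta_eta)
  then show ?thesis by (simp add: Lc_inverse(2)[OF assms])
qed

lemma Lc_matrix_inv:
  assumes "g \<in> Lc t"
  shows "matrix_inv g \<in> Lc t"
proof -
  let ?h = "eta t ** transpose g ** eta t"
  have "transpose ?h ** eta t ** ?h = eta t ** (g ** ((eta t ** eta t) ** (eta t ** transpose g))) ** eta t"
    by (simp add: matrix_transpose_mul transpose_eta matrix_mul_assoc[symmetric])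
  also have "\<dots> = eta t ** (g ** eta t ** transpose g) ** eta t"
    by (simp add: eta_eta matrix_mul_assoc)
  also have "\<dots> = eta t" by (simp add: Lc_transpose[OF assms] eta_eta)
  finally have "transpose ?h ** eta t ** ?h = eta t" .
  moreover have "det ?h = 1"
    using assms det_eta_squared[of t] by (simp add: det_mul Lc_def)
  ultimately show ?thesis
    by (simp add: Lc_inverse[OF assms]) (simp add: Lc_def)
qed

text \<open>Up to sign, the inverse has the entries of the transpose, so it inherits reality, the
  time-time entry and holomorphic dependence on parameters.\<close>

lemma matrix_inv_component:
  assumes "g \<in> Lc t"
  shows "matrix_inv g $ i $ j = (if i = t then 1 else -1) * g $ j $ i * (if j = t then 1 else -1)"
  by (simp add: Lc_inverse[OF assms] mult_eta eta_mult transpose_def)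

lemma Lup_matrix_inv:
  assumes "g \<in> Lup t"
  shows "matrix_inv g \<in> Lup t"
proof -
  have "g \<in> Lc t" using assms by (simp add: Lup_def Lplus_def)
  then show ?thesis
    using assms by (simp add: Lup_def Lplus_def Lc_matrix_inv matrix_inv_component)
qed

lemma Lc_mult:
  assumes "g \<in> Lc t" "h \<in> Lc t"
  shows "g ** h \<in> Lc t"
proof -
  have "transpose (g ** h) ** eta t ** (g ** h) = transpose h ** (transpose g ** eta t ** g) ** h"
    by (simp add: matrix_transpose_mul matrix_mul_assoc)
  then show ?thesis using assms by (simp add: Lc_def det_mul)
qed

text \<open>The time-time entry of \<open>g ** eta t ** transpose g = eta t\<close> says that the
  squared time entry of this row exceeds the sum of its squared space entries by 1.\<close>

lemma Lplus_time_row: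
  assumes "g \<in> Lplus t" "x \<noteq> t"
  shows "\<bar>Re (g $ t $ x)\<bar> < \<bar>Re (g $ t $ t)\<bar>"
proof -
  have re: "g $ t $ j = of_real (Re (g $ t $ j))" for j
    using assms by (simp add: Lplus_def complex_eq_iff)
  have "(g ** eta t ** transpose g) $ t $ t = 1"
    using assms Lc_transpose[of g t] by (simp add: Lplus_def eta_def)
  then have "(\<Sum>k\<in>UNIV. g $ t $ k * (if k = t then 1 else -1) * g $ t $ k) = 1"
    by (simp add: matrix_matrix_mult_def[of "g ** eta t"] mult_eta transpose_def)
  then have "(\<Sum>k\<in>UNIV. Re (g $ t $ k * (if k = t then 1 else -1) * g $ t $ k)) = 1"
    by (metis Re_sum one_complex.sel(1))
  moreover have "Re (g $ t $ k * (if k = t then 1 else -1) * g $ t $ k)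
      = (if k = t then 1 else -1) * (Re (g $ t $ k))\<^sup>2" for k
    using re[of k] by (auto simp: power2_eq_square) (metis Im_complex_of_real)+
  ultimately have s: "(\<Sum>k\<in>UNIV. (if k = t then 1 else -1) * (Re (g $ t $ k))\<^sup>2) = 1"
    by simp
  have "(\<Sum>k\<in>UNIV. (if k = t then 1 else -1) * (Re (g $ t $ k))\<^sup>2)
      = (Re (g $ t $ t))\<^sup>2 - (\<Sum>k\<in>UNIV - {t}. (Re (g $ t $ k))\<^sup>2)"
    by (subst sum.remove[of UNIV t]) (auto simp: sum_negf[symmetric] intro!: sum.cong)
  moreover have "(Re (g $ t $ x))\<^sup>2 \<le> (\<Sum>k\<in>UNIV - {t}. (Re (g $ t $ k))\<^sup>2)"
    using assms(2) by (intro member_le_sum) auto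
  ultimately have "(Re (g $ t $ x))\<^sup>2 < (Re (g $ t $ t))\<^sup>2" using s by linarith
  then show ?thesis by (metis abs_le_square_iff not_le)
qed

section \<open>Complexified boosts\<close>

text \<open>For \<open>t \<noteq> x\<close>, the hyperbolic rotation of complex rapidity
  \<open>z\<close> in the plane of \<open>t\<close> and \<open>x\<close>; at i pi it is -1 on that
  plane.\<close>

definition boost :: "'d::finite \<Rightarrow> 'd \<Rightarrow> complex \<Rightarrow> complex^'d^'d" where
  "boost t x z = (\<chi> i j.
     if i = t then (if j = t then cosh z else if j = x then sinh z else 0)
     else if i = x then (if j = t then sinh z else if j = x then cosh z else 0)
     else if i = j then 1 else 0)"

lemma sum_two_points:
  fixes a b :: "'a::finite"
  assumes "a \<noteq> b" "\<And>k. k \<noteq> a \<Longrightarrow> k \<noteq> b \<Longrightarrow> f k = 0"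
  shows "sum f UNIV = f a + (f b :: 'c::comm_monoid_add)"
proof -
  have "sum f UNIV = sum f {a, b}"
    using assms(2) by (intro sum.mono_neutral_right) auto
  then show ?thesis using assms(1) by simp
qed

lemma boost_mult:
  assumes "t \<noteq> x"
  shows "(boost t x z ** A) $ i $ j =
    (if i = t then cosh z * A $ t $ j + sinh z * A $ x $ j
     else if i = x then sinh z * A $ t $ j + cosh z * A $ x $ j else A $ i $ j)"
proof -
  consider "i = t" | "i = x" | "i \<noteq> t" "i \<noteq> x" by blast
  then show ?thesis
  proof cases
    case 3
    then show ?thesis
      by (simp add: matrix_matrix_mult_def boost_def if_distrib[of "\<lambda>c. c * _"] cong: if_cong)
  qed (use assms in \<open>auto simp: matrix_matrix_mult_def boost_def sum_two_points[of t x]\<close>)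
qed

lemma boost_add:
  assumes "t \<noteq> x"
  shows "boost t x z ** boost t x w = boost t x (z + w)"
  using assms by (auto simp: vec_eq_iff boost_mult) (auto simp: boost_def cosh_add sinh_add algebra_simps)

lemma boost_0: "boost t x 0 = mat 1"
  by (simp add: vec_eq_iff boost_def mat_def)

lemma boost_isometry:
  assumes "t \<noteq> x"
  shows "transpose (boost t x z) ** eta t ** boost t x z = eta t"
proof -
  have "transpose (boost t x z) = boost t x z"
    by (auto simp: vec_eq_iff transpose_def boost_def)
  moreover have "boost t x z ** (eta t ** boost t x z) = eta t"
    using assms hyperbolic_pythagoras[of z]
    by (auto simp: vec_eq_iff boost_mult eta_mult)
       (auto simp: boost_def eta_def power2_eq_square algebra_simps)
  ultimately show ?thesis by (simp add: matrix_mul_assoc)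
qed

lemma boost_in_Lc:
  assumes "t \<noteq> x"
  shows "boost t x z \<in> Lc t"
proof -
  let ?B = "boost t x (z / 2)"
  \<comment> \<open>A boost is a square, so its determinant, a priori only \<open>\<plusminus>1\<close>, equals 1.\<close>
  have "det (transpose ?B ** eta t ** ?B) * det (eta t) = det (eta t) * det (eta t)"
    by (simp only: boost_isometry[OF assms])
  then have "det ?B * det ?B * (det (eta t) * det (eta t)) = det (eta t) * det (eta t)"
    by (simp add: det_mul mult_ac)
  then have "det ?B * det ?B = 1" by (simp add: det_eta_squared)
  then have "det (boost t x z) = 1"
    using boost_add[OF assms, of "z / 2" "z / 2"] det_mul[of ?B ?B] by simp
  then show ?thesis using boost_isometry[OF assms] by (simp add: Lc_def)
qed

lemma boost_holomorphic: "(\<lambda>z. boost t x (f z) $ i $ j) holomorphic_on UNIV"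
  if "f holomorphic_on UNIV"
proof -
  have "(\<lambda>z. cosh (f z)) holomorphic_on UNIV" "(\<lambda>z. sinh (f z)) holomorphic_on UNIV"
    unfolding cosh_field_def sinh_field_def using that by (auto intro!: holomorphic_intros)
  then show ?thesis
    by (cases "i = t"; cases "j = t"; cases "i = x"; cases "j = x"; cases "i = j")
       (simp_all add: boost_def)
qed

text \<open>The shift by i pi negates both exponentials, so the boost shifted in this way is still
  real at real \<open>y\<close>.\<close>

lemma cosh_plus_i_pi: "cosh (of_real y + \<i> * of_real pi) = (of_real (- cosh y) :: complex)"
  and sinh_plus_i_pi: "sinh (of_real y + \<i> * of_real pi) = (of_real (- sinh y) :: complex)"
proof -
  have 1: "exp (complex_of_real y + \<i> * complex_of_real pi) = - of_real (exp y)"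
    by (simp add: exp_add exp_of_real)
  have 2: "exp (- (complex_of_real y + \<i> * complex_of_real pi)) = - of_real (exp (- y))"
    by (simp only: exp_minus[of "_ + _"] 1 inverse_minus_eq) (simp add: exp_minus)
  show "cosh (of_real y + \<i> * of_real pi) = (of_real (- cosh y) :: complex)"
    "sinh (of_real y + \<i> * of_real pi) = (of_real (- sinh y) :: complex)"
    unfolding cosh_field_def sinh_field_def 1 2 by (simp_all add: field_simps)
qed

lemma mult_boost:
  assumes "t \<noteq> x"
  shows "(A ** boost t x z) $ i $ j =
    (if j = t then A $ i $ t * cosh z + A $ i $ x * sinh z
     else if j = x then A $ i $ t * sinh z + A $ i $ x * cosh z else A $ i $ j)"
proof -
  consider "j = t" | "j = x" | "j \<noteq> t" "j \<noteq> x" by blast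
  then show ?thesis
  proof cases
    case 3
    then have "A $ i $ k * boost t x z $ k $ j = (if k = j then A $ i $ j else 0)" for k
      by (simp add: boost_def)
    with 3 show ?thesis
      by (simp add: matrix_matrix_mult_def)
  qed (use assms in \<open>auto simp: matrix_matrix_mult_def boost_def sum_two_points[of t x]\<close>)
qed

text \<open>The shift flips the sign of the time-time entry, which becomes
  \<open>a * cosh y - b * sinh y\<close> with \<open>a\<close> and \<open>b\<close> as defined in
  the proof; it is positive since the time row gives \<open>\<bar>b\<bar> < a\<close>.\<close>

lemma Ldown_boost:
  assumes "g \<in> Ldown t" "t \<noteq> x"
  shows "g ** boost t x (of_real y + \<i> * of_real pi) \<in> Lup t"
proof -
  let ?h = "g ** boost t x (of_real y + \<i> * of_real pi)"
  have g: "g \<in> Lplus t" "Re (g $ t $ t) < 0" using assms by (auto simp: Ldown_def)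
  then have "?h \<in> Lc t" using assms by (simp add: Lplus_def Lc_mult boost_in_Lc)
  moreover have "Im (?h $ i $ j) = 0" for i j
    using g(1) by (simp add: mult_boost[OF assms(2)] cosh_plus_i_pi sinh_plus_i_pi Lplus_def)
  moreover have "Re (?h $ t $ t) > 0"
  proof -
    define a b where "a = - Re (g $ t $ t)" and "b = Re (g $ t $ x)"
    have ab: "\<bar>b\<bar> < a" using Lplus_time_row[OF g(1), of x] assms(2) g(2) by (simp add: a_def b_def)
    have s: "\<bar>sinh y\<bar> \<le> cosh y"
      using sinh_le_cosh_real[of y] sinh_le_cosh_real[of "-y"] by simp
    have "b * sinh y \<le> \<bar>b\<bar> * cosh y"
      using s by (metis abs_ge_self abs_ge_zero abs_mult mult_left_mono order_trans)
    also have "\<dots> < a * cosh y" using ab by (simp add: cosh_real_pos)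
    finally show ?thesis
      by (simp add: mult_boost[OF assms(2)] cosh_plus_i_pi sinh_plus_i_pi a_def b_def)
  qed
  ultimately show ?thesis by (simp add: Lup_def Lplus_def)
qed

section \<open>The classical action on words, reversal and the commutative quotient\<close>

text \<open>The generator images in \<open>classical_action\<close>, with the two matrices as free
  parameters so that both can vary along a curve.\<close>

definition symbol_image ::
  "complex^'m^'m \<Rightarrow> complex^'d^'d \<Rightarrow> ('m::finite,'d::finite) gen \<Rightarrow> ('m,'d) K" where
  "symbol_image A B = (\<lambda>(i, js).
     field_symbol (axis i 1 v* A) (map (\<lambda>j. B *v axis j 1) js))"

lemma classical_action_eq:
  "classical_action R Om g = kext (symbol_image (R (matrix_inv g)) (Om g))"
  by (simp add: classical_action_def symbol_image_def)

lemma kmul_homogeneous_one: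
  assumes "\<And>w. length w \<noteq> 1 \<Longrightarrow> p w = 0"
  shows "kmul p q [] = 0" "kmul p q (b # v) = p [b] * q v"
proof -
  show "kmul p q [] = 0" using assms[of "[]"] by (simp add: kmul_def)
  \<comment> \<open>Only the cut after the first letter leaves a left factor of length one.\<close>
  have "kmul p q (b # v) = (\<Sum>k\<in>{1}. p (take k (b # v)) * q (drop k (b # v)))"
    unfolding kmul_def
    by (rule sum.mono_neutral_right) (auto intro!: assms simp: min_def split: if_splits)
  then show "kmul p q (b # v) = p [b] * q v" by simp
qed

lemma kprod_kgen: "kprod (map kgen ws) v = (if v = ws then 1 else 0)"
proof (induction ws arbitrary: v)
  case Nil
  then show ?case by (simp add: kprod_def kone_def)
next
  case (Cons a ws)
  have "kgen a w = 0" if "length w \<noteq> 1" for w using that by (auto simp: kgen_def)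
  note k = kmul_homogeneous_one[of "kgen a", OF this]
  from Cons show ?case
    by (cases v) (auto simp: kprod_def k, auto simp: kgen_def)
qed

text \<open>Word reversal on coefficients. Finite support matters, since a sum over an infinite
  support would be 0 by convention.\<close>

lemma S_anti_eq:
  assumes "p \<in> Kset"
  shows "S_anti p v = p (rev v)"
proof -
  have "S_anti p v = (\<Sum>w\<in>{w. p w \<noteq> 0}. if w = rev v then p w else 0)"
    unfolding S_anti_def kext_anti_def
    by (intro sum.cong) (auto simp: rev_map kprod_kgen)
  then show ?thesis using assms by (auto simp: Kset_def)
qed

lemma S_anti_in_Kset:
  assumes "p \<in> Kset"
  shows "S_anti p \<in> Kset"
proof -
  have "{v. S_anti p v \<noteq> 0} = rev ` {w. p w \<noteq> 0}"
    by (auto simp: S_anti_eq[OF assms] image_iff) (metis rev_rev_ident)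
  then show ?thesis using assms by (simp add: Kset_def)
qed

text \<open>Reversal permutes the words with a given multiset of letters.\<close>

lemma cquot_S_anti:
  assumes "p \<in> Kset"
  shows "cquot (S_anti p) = cquot p"
  unfolding cquot_def
proof
  fix M
  show "(\<Sum>w | mset w = M. S_anti p w) = (\<Sum>w | mset w = M. p w)"
    by (rule sum.reindex_bij_witness[of _ rev rev]) (auto simp: S_anti_eq[OF assms])
qed

lemma symbol_image_homogeneous: "length w \<noteq> 1 \<Longrightarrow> symbol_image A B x w = 0"
  by (auto simp: symbol_image_def field_symbol_def split: prod.split list.split)

text \<open>Each coefficient is 0 or a monomial in matrix entries; both holomorphy and preservation
  of tensor degree are read off from this.\<close>

lemma symbol_image_singleton:
  "symbol_image A B (i, js) [(i', js')] =
    (if length js' = length js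
     then A $ i $ i' * (\<Prod>k<length js'. B $ (js' ! k) $ (js ! k)) else 0)"
proof -
  have "(axis i 1 v* A) $ i' = A $ i $ i'"
    by (simp add: vector_matrix_mult_def axis_def if_distrib[of "\<lambda>c. c * _"] if_distrib[of "\<lambda>c. _ * c"] cong: if_cong)
  moreover have "(B *v axis j 1) $ k = B $ k $ j" for j k
    by (simp add: matrix_vector_mult_def axis_def if_distrib[of "\<lambda>c. _ * c"] cong: if_cong)
  ultimately show ?thesis
    by (auto simp: symbol_image_def field_symbol_def intro!: prod.cong)
qed

lemma kprod_symbol_image:
  "kprod (symbol_image A B x # ps) [] = 0"
  "kprod (symbol_image A B x # ps) (b # v) = symbol_image A B x [b] * kprod ps v"
  using kmul_homogeneous_one[of "symbol_image A B x", OF symbol_image_homogeneous]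
  by (simp_all add: kprod_def)

text \<open>The action preserves the list of tensor degrees of the field symbols in a word.\<close>

definition shape :: "('m, 'd) gen list \<Rightarrow> nat list" where
  "shape = map (length \<circ> snd)"

text \<open>The alphabet is infinite, but only finitely many letters have a given tensor
  degree.\<close>

lemma finite_shape: "finite {v :: ('m::finite, 'd::finite) gen list. shape v = ns}"
proof (induction ns)
  case Nil
  then show ?case by (simp add: shape_def)
next
  case (Cons n ns)
  have "finite {js :: 'd list. set js \<subseteq> UNIV \<and> length js = n}"
    by (rule finite_lists_length_eq) simp
  then have "finite {js :: 'd list. length js = n}" by simp
  then have "finite ((\<lambda>(x, v). x # v) ` ((UNIV \<times> {js. length js = n}) \<times> {v :: ('m,'d) gen list. shape v = ns}))"
    using Cons by simp
  then show ?case
    by (rule finite_subset[rotated]) (force simp: shape_def Cons_eq_map_conv image_iff)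
qed

lemma kprod_symbol_image_shape:
  "kprod (map (symbol_image A B) ws) v \<noteq> 0 \<Longrightarrow> shape v = shape ws"
proof (induction ws arbitrary: v)
  case Nil
  then show ?case by (simp add: kprod_def kone_def split: if_splits)
next
  case (Cons x ws)
  then show ?case
    by (cases v; cases x) (auto simp: kprod_symbol_image symbol_image_singleton shape_def split: if_splits)
qed

text \<open>The bound on the support does not depend on \<open>A\<close> or \<open>B\<close>, hence
  is uniform along a curve of matrices.\<close>

lemma kext_symbol_image_support:
  assumes "kext (symbol_image A B) p v \<noteq> 0"
  shows "shape v \<in> shape ` {w. p w \<noteq> 0}"
proof -
  obtain w where "p w \<noteq> 0" "p w * kprod (map (symbol_image A B) w) v \<noteq> 0"
    using assms unfolding kext_def by (metis (mono_tags, lifting) mem_Collect_eq sum.neutral)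
  then show ?thesis using kprod_symbol_image_shape by force
qed

lemma finite_shape_in: "finite N \<Longrightarrow> finite {v :: ('m::finite, 'd::finite) gen list. shape v \<in> N}"
proof -
  assume "finite N"
  moreover have "{v :: ('m, 'd) gen list. shape v \<in> N} = (\<Union>ns\<in>N. {v. shape v = ns})" by auto
  ultimately show ?thesis by (simp add: finite_shape)
qed

lemma kext_symbol_image_in_Kset:
  fixes p :: "('m::finite, 'd::finite) K"
  assumes "p \<in> Kset"
  shows "kext (symbol_image A B) p \<in> Kset"
proof -
  have "{v. kext (symbol_image A B) p v \<noteq> 0} \<subseteq> {v. shape v \<in> shape ` {w. p w \<noteq> 0}}"
    using kext_symbol_image_support by blast
  moreover have "finite {v :: ('m, 'd) gen list. shape v \<in> shape ` {w. p w \<noteq> 0}}"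
    using assms by (intro finite_shape_in) (simp add: Kset_def)
  ultimately show ?thesis by (simp add: Kset_def finite_subset)
qed

text \<open>Supplies the parameter-independent support set required by
  \<open>affine_identity\<close>.\<close>

lemma cquot_kext_symbol_image_support:
  assumes "M \<notin> mset ` {v. shape v \<in> shape ` {w. p w \<noteq> 0}}"
  shows "cquot (kext (symbol_image A B) p) M = 0"
  unfolding cquot_def using assms kext_symbol_image_support by (intro sum.neutral) blast

lemma kprod_symbol_image_holomorphic:
  assumes "\<And>k l. (\<lambda>z. A z $ k $ l) holomorphic_on U" "\<And>k l. (\<lambda>z. B z $ k $ l) holomorphic_on U"
  shows "(\<lambda>z. kprod (map (symbol_image (A z) (B z)) ws) v) holomorphic_on U"
proof (induction ws arbitrary: v)
  case Nil
  then show ?case by (simp add: kprod_def)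
next
  case (Cons x ws)
  obtain i js where x: "x = (i, js)" by fastforce
  show ?case
  proof (cases v)
    case (Cons b v')
    obtain i' js' where b: "b = (i', js')" by fastforce
    have "(\<lambda>z. symbol_image (A z) (B z) x [b]) holomorphic_on U"
      unfolding x b symbol_image_singleton
      by (cases "length js' = length js") (auto intro!: holomorphic_intros assms)
    then show ?thesis
      using Cons.IH unfolding Cons list.map kprod_symbol_image by (intro holomorphic_on_mult)
  qed (simp add: kprod_symbol_image)
qed

text \<open>The index sets of both sums are independent of \<open>z\<close>, so holomorphy passes
  from the words to the coefficients.\<close>

lemma cquot_kext_symbol_image_holomorphic:
  assumes "\<And>k l. (\<lambda>z. A z $ k $ l) holomorphic_on U" "\<And>k l. (\<lambda>z. B z $ k $ l) holomorphic_on U"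
  shows "(\<lambda>z. cquot (kext (symbol_image (A z) (B z)) p) M) holomorphic_on U"
  unfolding cquot_def kext_def
  by (intro holomorphic_intros kprod_symbol_image_holomorphic assms)

section \<open>Continuation from the orthochronous to the time-reversing component\<close>

theorem theorem2:
  fixes t :: "'d::finite"
    and rho :: "complex^'d^'d \<Rightarrow> real^'m::finite^'m"
    and rhoC :: "complex^'d^'d \<Rightarrow> complex^'m^'m"
    and om :: "complex^'d^'d \<Rightarrow> real^'d^'d"
    and omC :: "complex^'d^'d \<Rightarrow> complex^'d^'d"
    and D :: "('m,'d) K set"
  assumes dim: "CARD('d) \<ge> 3"
    and rho_rep: "real_rep (Lup t) rho"
    and rhoC_rep: "holo_rep (Lc t) rhoC"
    and rhoC_ext: "\<forall>g\<in>Lup t. rhoC g = cmat (rho g)"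
    and om_rep: "real_rep (Lup t) om"
    and omC_rep: "holo_rep (Lc t) omC"
    and omC_ext: "\<forall>g\<in>Lup t. omC g = cmat (om g)"
    and D: "comm_ffth D"
    and inv: "\<forall>g\<in>Lup t. invariant_under
               (classical_action (\<lambda>h. cmat (rho h)) (\<lambda>h. cmat (om h)) g) D"
  shows "\<forall>g\<in>Ldown t. invariant_under (S_anti \<circ> classical_action rhoC omC g) D"
proof
  fix g assume g: "g \<in> Ldown t"
  obtain Dc where D_props: "complex_affine Dc \<and> D = {p \<in> Kset. cquot p \<in> Dc}"
    using D unfolding comm_ffth_def by (rule exE)
  note Dc = D_props[THEN conjunct1] and D_eq = D_props[THEN conjunct2]
  \<comment> \<open>A space direction is needed to span a boost plane with \<open>t\<close>.\<close>
  have "\<exists>x. t \<noteq> x"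
  proof (rule ccontr)
    assume "\<nexists>x. t \<noteq> x"
    then have "(UNIV :: 'd set) = {t}" by auto
    then have "CARD('d) = card {t}" by (rule arg_cong)
    then show False using dim by simp
  qed
  then obtain x where x: "t \<noteq> x" by blast
  \<comment> \<open>The shift by i pi puts the orthochronous values on the real axis and
    \<open>g\<close> itself at -i pi.\<close>
  define \<gamma> where "\<gamma> z = g ** boost t x (z + \<i> * of_real pi)" for z
  have \<gamma>_Lc: "\<gamma> z \<in> Lc t" for z
    using g boost_in_Lc[OF x] by (auto simp: \<gamma>_def Ldown_def Lplus_def intro: Lc_mult)
  have \<gamma>_Lup: "\<gamma> (of_real y) \<in> Lup t" for y :: real
    unfolding \<gamma>_def using g x by (rule Ldown_boost)
  have \<gamma>_end: "\<gamma> (- \<i> * of_real pi) = g" by (simp add: \<gamma>_def boost_0)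
  have \<gamma>_hol: "(\<lambda>z. \<gamma> z $ i $ j) holomorphic_on UNIV" for i j
    unfolding \<gamma>_def by (auto simp: matrix_matrix_mult_def intro!: holomorphic_intros boost_holomorphic)
  \<comment> \<open>The action evaluates \<open>rhoC\<close> at the inverse, so the inverse curve
    must be holomorphic as well.\<close>
  have inv_hol: "(\<lambda>z. matrix_inv (\<gamma> z) $ i $ j) holomorphic_on UNIV" for i j
    unfolding matrix_inv_component[OF \<gamma>_Lc] by (intro holomorphic_intros \<gamma>_hol)
  have om_hol: "(\<lambda>z. omC (\<gamma> z) $ k $ l) holomorphic_on UNIV" for k l
    using omC_rep \<gamma>_Lc \<gamma>_hol by (auto simp: holo_rep_def intro: holo_on_compose)
  have rho_hol: "(\<lambda>z. rhoC (matrix_inv (\<gamma> z)) $ k $ l) holomorphic_on UNIV" for k l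
    using rhoC_rep Lc_matrix_inv[OF \<gamma>_Lc] inv_hol
    by (auto simp: holo_rep_def intro: holo_on_compose[where \<gamma> = "\<lambda>z. matrix_inv (\<gamma> z)"])
  show "invariant_under (S_anti \<circ> classical_action rhoC omC g) D"
    unfolding invariant_under_def
  proof
    fix p assume p: "p \<in> D"
    then have pK: "p \<in> Kset" by (simp add: D_eq)
    define q where "q z = cquot (classical_action rhoC omC (\<gamma> z) p)" for z
    have q_real: "q (of_real y) \<in> Dc" for y :: real
    proof -
      \<comment> \<open>Both the group element and its inverse are orthochronous here, and there the
        holomorphic extensions agree with the real representations.\<close>
      have "classical_action rhoC omC (\<gamma> (of_real y))
          = classical_action (\<lambda>h. cmat (rho h)) (\<lambda>h. cmat (om h)) (\<gamma> (of_real y))"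
        using rhoC_ext omC_ext \<gamma>_Lup[of y] Lup_matrix_inv[OF \<gamma>_Lup[of y]]
        by (simp add: classical_action_def)
      then show ?thesis
        using inv \<gamma>_Lup[of y] p by (auto simp: q_def invariant_under_def D_eq)
    qed
    have fin: "finite (mset ` {v :: ('m,'d) gen list. shape v \<in> shape ` {w. p w \<noteq> 0}})"
      using pK by (intro finite_imageI finite_shape_in) (simp add: Kset_def)
    have "q (- \<i> * of_real pi) \<in> Dc"
    proof (rule affine_identity[where A = Dc and q = q, OF _ fin _ _ q_real])
      show "(\<lambda>k. u * a k + v * b k) \<in> Dc" if "a \<in> Dc" "b \<in> Dc" "u + v = 1" for a b u v
        using Dc that by (simp add: complex_affine_def)
      show "(\<lambda>z. q z k) holomorphic_on UNIV" for k
        unfolding q_def classical_action_eq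
        by (intro cquot_kext_symbol_image_holomorphic om_hol rho_hol)
      show "q z k = 0" if "k \<notin> mset ` {v. shape v \<in> shape ` {w. p w \<noteq> 0}}" for z k
        unfolding q_def classical_action_eq using that by (rule cquot_kext_symbol_image_support)
    qed
    then have "cquot (classical_action rhoC omC g p) \<in> Dc"
      unfolding q_def \<gamma>_end .
    moreover have "classical_action rhoC omC g p \<in> Kset"
      unfolding classical_action_eq using pK by (rule kext_symbol_image_in_Kset)
    \<comment> \<open>Membership in \<open>D\<close> depends only on the commutative image, which
      \<open>S_anti\<close> leaves unchanged.\<close>
    ultimately show "(S_anti \<circ> classical_action rhoC omC g) p \<in> D"
      by (simp add: D_eq S_anti_in_Kset cquot_S_anti)
  qed
qed

end
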